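(* Let $n\ge 1$. The number of frustrated parking functions of length $n$ such that once a spot is unlucky all later spots are unlucky (i.e. if spot $i$ is unlucky then every spot $j>i$ is unlucky) is the $n$th Fubini number. Moreover, the number of frustrated parking functions of length $n$ such that once a car is unlucky all remaining cars are unlucky (i.e. if car $i$ is unlucky then every car $j>i$ is unlucky) is the $n$th Fubini number.
   Context: Let $n\ge 1$ and $[n]=\{1,2,\dots,n\}$. There are $n$ cars and $n$ parking spots numbered $1,\dots,n$, all initially empty. Given a preference sequence $(a_1,\dots,a_n)\in[n]^n$, cars $1,2,\dots,n$ enter in this order. If spot $a_i$ is unoccupied when car $i$ enters, car $i$ parks in spot $a_i$. Otherwise car $i$ parks in the largest-numbered unoccupied spot greater than $a_i$, if such a spot exists; if none exists, car $i$ cannot park. The sequence $(a_1,\dots,a_n)$ is a frustrated parking function of length $n$ if all $n$ cars can park under this rule. For a frustrated parking function, car $j$ is lucky if it parks in its preferred spot $a_j$, and unlucky otherwise; a spot is lucky if the car that parks in it is lucky, and unlucky otherwise. The $n$th Fubini number (ordered Bell number) is $\sum_{k=1}^n k!\,S(n,k)$, where $S(n,k)$ is the Stirling number of the second kind, the number of set partitions of an $n$-element set into $k$ blocks. *)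

theory Defs
  imports Complex_Main "HOL-Library.Disjoint_Sets"
begin

text \<open>Spots are \<open>1, \<dots>, n\<close> and \<open>occ\<close> is the set of occupied spots; the result is \<open>None\<close> if the
  car cannot park.\<close>

definition frustrated_spot :: "nat \<Rightarrow> nat set \<Rightarrow> nat \<Rightarrow> nat option" where
  "frustrated_spot n occ a =
     (if a \<notin> occ then Some a
      else let free = {s. a < s \<and> s \<le> n \<and> s \<notin> occ}
           in if free = {} then None else Some (Max free))"

fun park_from :: "nat \<Rightarrow> nat set \<Rightarrow> nat list \<Rightarrow> nat option list" where
  "park_from n occ [] = []"
| "park_from n occ (a # as) =
     (case frustrated_spot n occ a of
        None \<Rightarrow> None # park_from n occ as
      | Some s \<Rightarrow> Some s # park_from n (insert s occ) as)"

definition outcome :: "nat \<Rightarrow> nat list \<Rightarrow> nat option list" where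
  "outcome n as = park_from n {} as"

definition frustrated_pf :: "nat \<Rightarrow> nat list \<Rightarrow> bool" where
  "frustrated_pf n as \<longleftrightarrow>
     length as = n \<and> set as \<subseteq> {1..n} \<and> (\<forall>x \<in> set (outcome n as). x \<noteq> None)"

text \<open>Cars are numbered from 1 whereas list positions start at 0, hence the index \<open>j - 1\<close> for
  car \<open>j\<close>.\<close>

definition car_spot :: "nat \<Rightarrow> nat list \<Rightarrow> nat \<Rightarrow> nat option" where
  "car_spot n as j = outcome n as ! (j - 1)"

definition lucky_car :: "nat \<Rightarrow> nat list \<Rightarrow> nat \<Rightarrow> bool" where
  "lucky_car n as j \<longleftrightarrow> car_spot n as j = Some (as ! (j - 1))"

definition lucky_spot :: "nat \<Rightarrow> nat list \<Rightarrow> nat \<Rightarrow> bool" where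
  "lucky_spot n as s \<longleftrightarrow> (\<exists>j \<in> {1..n}. car_spot n as j = Some s \<and> lucky_car n as j)"

definition stirling2 :: "nat \<Rightarrow> nat \<Rightarrow> nat" where
  "stirling2 n k = card {P. partition_on {1..n} P \<and> card P = k}"

definition fubini :: "nat \<Rightarrow> nat" where
  "fubini n = (\<Sum>k = 1..n. fact k * stirling2 n k)"

end

theory Submission
  imports Defs "HOL-Combinatorics.Multiset_Permutations"
begin

text \<open>The Fubini number \<open>\<Sum>k. k! S(n,k)\<close> counts the ordered set partitions of \<open>{1..n}\<close>: a partition
  into \<open>k\<close> blocks can be listed in \<open>k!\<close> orders. Both families of parking functions are shown to be
  in bijection with ordered set partitions.

  The observation behind both halves is that an unlucky car takes the largest spot that is still
  free: everything above the spot it takes is occupied, because its preference lies below that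
  spot. Hence the spots of all cars arriving after an unlucky car lie below its spot
  (\<open>unlucky_parks\<close>).

  Suppose the lucky spots are \<open>1, \<dots>, k\<close>. Each of them is the preference of the car
  parked there. No car prefers a spot \<open>s > k\<close>: it would be unlucky, so \<open>s\<close> was taken before it
  by another car, itself unlucky because \<open>s > k\<close>; but then the later car would park below \<open>s\<close>.
  So the preference set is exactly \<open>{1..k}\<close>. Conversely, if the
  preferences are exactly \<open>1, \<dots>, k\<close>, then at every moment the occupied spots are some lucky ones
  in \<open>{1..k}\<close> together with a segment at the top, and every car can park. These words are the
  surjections of \<open>{1..n}\<close> onto some \<open>{1..k}\<close>, and their lists of fibres are the ordered set
  partitions (\<open>bij_betw_letter_classes\<close>).

  Suppose instead that the lucky cars are \<open>1, \<dots>, k\<close>. Their preferences form a list \<open>\<sigma>\<close> without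
  repetitions, and the remaining cars fill the spots outside \<open>\<sigma>\<close> in decreasing order. The car
  that takes the spot \<open>f\<close> prefers an occupied spot below \<open>f\<close>, and such a spot belongs to \<open>\<sigma>\<close>, as the
  other occupied ones lie above \<open>f\<close>. So a parking function amounts to \<open>\<sigma>\<close> together with a choice,
  for every \<open>f\<close> outside \<open>\<sigma>\<close>, of a smaller element of \<open>\<sigma>\<close>. This is an ordered set partition in which
  \<open>\<sigma>\<close> lists the minima of the blocks and \<open>f\<close> is sent to the minimum of its own block
  (\<open>bij_betw_min_code\<close>).\<close>

section \<open>Ordered set partitions\<close>

definition ordered_partitions :: "'a set \<Rightarrow> 'a set list set" where
  "ordered_partitions A = {bs. distinct bs \<and> partition_on A (set bs)}"

lemma map_fibres_in_ordered_partitions: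
  assumes "distinct is" "set is = f ` A"
  shows "map (\<lambda>i. {x \<in> A. f x = i}) is \<in> ordered_partitions A"
proof -
  let ?C = "\<lambda>i. {x \<in> A. f x = i}"
  have "inj_on ?C (f ` A)" by (intro inj_onI) blast
  moreover have "partition_on A (?C ` f ` A)"
    by (intro partition_onI) (auto simp: disjnt_def)
  ultimately show ?thesis using assms by (simp add: ordered_partitions_def distinct_map)
qed

lemma finite_partitions: "finite A \<Longrightarrow> finite {P. partition_on A P}"
  by (rule finite_subset[of _ "Pow (Pow A)"]) (auto simp: partition_on_def)

lemma card_ordered_partitions:
  assumes "finite A"
  shows "card (ordered_partitions A) = (\<Sum>P | partition_on A P. fact (card P))"
proof -
  have fin: "finite P" if "partition_on A P" for P
    using that assms finite_elements by blast
  have "ordered_partitions A = (\<Union>P\<in>{P. partition_on A P}. permutations_of_set P)"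
    by (auto simp: ordered_partitions_def permutations_of_set_def)
  also have "card \<dots> = (\<Sum>P | partition_on A P. card (permutations_of_set P))"
    by (rule card_UN_disjoint) (auto simp: finite_partitions assms dest: permutations_of_setD)
  also have "\<dots> = (\<Sum>P | partition_on A P. fact (card P))"
    by (intro sum.cong) (auto simp: fin)
  finally show ?thesis .
qed

text \<open>The hypothesis on \<open>n\<close> is what allows the sum defining \<open>fubini\<close> to start at \<open>k = 1\<close>: the empty set
  has one partition, with no blocks.\<close>

lemma fubini_eq_card_ordered_partitions:
  assumes "n \<ge> 1"
  shows "fubini n = card (ordered_partitions {1..n})"
proof -
  let ?Ps = "{P. partition_on {1..n} P}"
  have fin: "finite ?Ps" by (simp add: finite_partitions)
  have range: "card P \<in> {1..n}" if P: "partition_on {1..n} P" for P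
  proof -
    have "finite P" using P finite_elements by blast
    moreover have "P \<noteq> {}" using P assms by (auto simp: partition_on_def)
    moreover have "card P \<le> card {1..n}"
    proof (rule card_le_if_inj_on_rel[where r = "\<lambda>B x. x \<in> B"])
      fix B assume "B \<in> P"
      then have "B \<noteq> {}" "B \<subseteq> {1..n}" using partition_onD1[OF P] partition_onD3[OF P] by auto
      then show "\<exists>x. x \<in> {1..n} \<and> x \<in> B" by blast
    qed (use disjointD[OF partition_onD2[OF P]] in auto)
    ultimately show ?thesis by (simp add: Suc_le_eq card_gt_0_iff)
  qed
  have "(\<Sum>P\<in>?Ps. fact (card P)) = (\<Sum>k = 1..n. \<Sum>P | P \<in> ?Ps \<and> card P = k. fact (card P))"
    by (rule sum.group[symmetric]) (use range fin in auto)
  also have "\<dots> = fubini n"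
    unfolding fubini_def stirling2_def by (intro sum.cong) auto
  finally show ?thesis by (simp add: card_ordered_partitions)
qed

section \<open>Words using an initial segment of the letters\<close>

definition initial_words :: "nat \<Rightarrow> nat list set" where
  "initial_words n = {w. length w = n \<and> (\<exists>k. set w = {1..k})}"

text \<open>Letters of \<open>w\<close> are addressed by positions \<open>1, \<dots>, length w\<close>, so that the classes partition
  \<open>{1..n}\<close>. For an initial word \<open>card (set w)\<close> is its largest letter.\<close>

definition letter_classes :: "nat list \<Rightarrow> nat set list" where
  "letter_classes w =
     map (\<lambda>j. {x \<in> {1..length w}. w ! (x - 1) = j}) [1..<Suc (card (set w))]"

text \<open>A surjection onto \<open>{1..k}\<close> is the same thing as the list of its \<open>k\<close> fibres. In the other direction,
  the letter at position \<open>x\<close> is the index, counted from 1, of the block that contains \<open>x\<close>.\<close>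

lemma bij_betw_letter_classes:
  "bij_betw letter_classes (initial_words n) (ordered_partitions {1..n})"
proof (rule bij_betw_imageI)
  have nth: "w ! (x - 1) \<in> {1..card (set w)}"
    if w: "w \<in> initial_words n" and x: "x \<in> {1..n}" for w x
  proof -
    obtain k where k: "set w = {1..k}" "length w = n" using w unfolding initial_words_def by blast
    then have "w ! (x - 1) \<in> {1..k}" using x nth_mem[of "x - 1" w] by auto
    then show ?thesis using k by simp
  qed
  show "inj_on letter_classes (initial_words n)"
  proof (rule inj_onI)
    fix v w assume v: "v \<in> initial_words n" and w: "w \<in> initial_words n"
      and eq: "letter_classes v = letter_classes w"
    have len: "length v = n" "length w = n" using v w by (auto simp: initial_words_def)
    have "length (letter_classes v) = length (letter_classes w)" using eq by simp
    then have k: "card (set v) = card (set w)" by (simp add: letter_classes_def del: upt_Suc)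
    have "v ! i = w ! i" if "i < n" for i
    proof -
      have x: "Suc i \<in> {1..n}" using that by auto
      have "v ! i \<in> {1..card (set v)}" using nth[OF v x] by simp
      then have j: "v ! i \<in> set [1..<Suc (card (set v))]" by auto
      have "Suc i \<in> {x \<in> {1..n}. w ! (x - 1) = v ! i}"
        using eq j k len x unfolding letter_classes_def map_eq_conv by fastforce
      then show ?thesis by simp
    qed
    then show "v = w" using len by (simp add: list_eq_iff_nth_eq)
  qed
  show "letter_classes ` initial_words n = ordered_partitions {1..n}"
  proof (intro equalityI subsetI)
    fix bs assume "bs \<in> letter_classes ` initial_words n"
    then obtain w where w: "w \<in> initial_words n" and bs: "bs = letter_classes w" by auto
    have len: "length w = n" using w by (auto simp: initial_words_def)
    obtain k where k: "set w = {1..k}" using w unfolding initial_words_def by blast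
    have "{1..n} = Suc ` {..<n}" by (simp add: image_Suc_lessThan)
    then have "(\<lambda>x. w ! (x - 1)) ` {1..n} = set w"
      using len by (auto simp: image_image set_conv_nth)
    then show "bs \<in> ordered_partitions {1..n}"
      unfolding bs letter_classes_def len using k
      by (intro map_fibres_in_ordered_partitions) auto
  next
    fix bs assume "bs \<in> ordered_partitions {1..n}"
    then have d: "distinct bs" and p: "partition_on {1..n} (set bs)"
      by (auto simp: ordered_partitions_def)
    define ix where "ix x = (SOME j. j \<in> {1..length bs} \<and> x \<in> bs ! (j - 1))" for x
    have ix: "ix x \<in> {1..length bs} \<and> x \<in> bs ! (ix x - 1)" if x: "x \<in> {1..n}" for x
    proof -
      obtain B where "B \<in> set bs" "x \<in> B" using x p unfolding partition_on_def by blast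
      then obtain i where "i < length bs" "x \<in> bs ! i" by (auto simp: in_set_conv_nth)
      then have "Suc i \<in> {1..length bs} \<and> x \<in> bs ! (Suc i - 1)" by auto
      then show ?thesis unfolding ix_def by (rule someI)
    qed
    have uniq: "ix x = j" if "x \<in> {1..n}" "j \<in> {1..length bs}" "x \<in> bs ! (j - 1)" for x j
    proof -
      have i: "ix x - 1 < length bs" and j: "j - 1 < length bs" using ix[OF that(1)] that(2) by auto
      have "bs ! (ix x - 1) = bs ! (j - 1)"
        using nth_mem[OF i] nth_mem[OF j] ix[OF that(1)] that(3) partition_onD2[OF p]
        by (auto dest: disjointD)
      then show ?thesis using d i j ix[OF that(1)] that(2) by (auto simp: nth_eq_iff_index_eq)
    qed
    have sub: "bs ! (j - 1) \<subseteq> {1..n}" "bs ! (j - 1) \<noteq> {}" if "j \<in> {1..length bs}" for j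
    proof -
      have "bs ! (j - 1) \<in> set bs" using that by auto
      then show "bs ! (j - 1) \<subseteq> {1..n}" "bs ! (j - 1) \<noteq> {}" using p by (auto simp: partition_on_def)
    qed
    define w where "w = map ix [1..<Suc n]"
    have setw: "set w = {1..length bs}"
    proof -
      have "ix ` {1..n} = {1..length bs}"
      proof (intro equalityI subsetI)
        fix j assume j: "j \<in> {1..length bs}"
        obtain x where "x \<in> bs ! (j - 1)" using sub(2)[OF j] by blast
        then show "j \<in> ix ` {1..n}" using uniq[of x j] j sub(1)[OF j] by blast
      qed (use ix in auto)
      then show ?thesis by (simp add: w_def atLeastLessThanSuc_atLeastAtMost del: upt_Suc)
    qed
    have len: "length w = n" by (simp add: w_def)
    have nthw: "w ! (x - 1) = ix x" if "x \<in> {1..n}" for x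
      using that by (auto simp: w_def simp del: upt_Suc)
    have "letter_classes w = bs"
    proof (rule nth_equalityI)
      show "length (letter_classes w) = length bs" using setw by (simp add: letter_classes_def del: upt_Suc)
      fix i assume "i < length (letter_classes w)"
      then have i: "i < length bs" using setw by (simp add: letter_classes_def del: upt_Suc)
      have "letter_classes w ! i = {x \<in> {1..n}. w ! (x - 1) = Suc i}"
        using i setw len by (simp add: letter_classes_def del: upt_Suc)
      also have "\<dots> = {x \<in> {1..n}. ix x = Suc i}" using nthw by auto
      also have "\<dots> = bs ! i"
        using uniq[of _ "Suc i"] ix sub(1)[of "Suc i"] i by fastforce
      finally show "letter_classes w ! i = bs ! i" .
    qed
    moreover have "w \<in> initial_words n" using len setw by (auto simp: initial_words_def)
    ultimately show "bs \<in> letter_classes ` initial_words n" by blast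
  qed
qed

section \<open>Coding an ordered partition by its block minima\<close>

definition desc :: "nat set \<Rightarrow> nat list" where
  "desc A = rev (sorted_list_of_set A)"

lemma desc_props:
  assumes "finite A"
  shows "set (desc A) = A" "distinct (desc A)" "sorted_wrt (>) (desc A)"
  using assms by (simp_all add: desc_def sorted_wrt_rev)

text \<open>A strictly decreasing list is determined by its elements; this identifies the order in which
  unlucky cars fill the spots left by the lucky ones.\<close>

lemma desc_unique:
  assumes "sorted_wrt (>) xs"
  shows "xs = desc (set xs)"
proof -
  have "sorted_wrt (<) (rev xs)" using assms by (simp add: sorted_wrt_rev)
  then have "rev xs = sorted_list_of_set (set xs)"
    by (metis List.finite_set set_rev sorted_list_of_set.set_sorted_key_list_of_set
        strict_sorted_equal strict_sorted_list_of_set)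
  then show ?thesis by (simp add: desc_def rev_swap)
qed

definition block_min :: "nat set set \<Rightarrow> nat \<Rightarrow> nat" where
  "block_min P x = Min (\<Union>{B \<in> P. x \<in> B})"

text \<open>The union in \<open>block_min\<close> is just the block of \<open>x\<close> when \<open>P\<close> is a partition. The code of an ordered
  partition lists the block minima in the given order and then, for the other elements in
  decreasing order, the minimum of the block of each.\<close>

definition min_code :: "nat set \<Rightarrow> nat set list \<Rightarrow> nat list" where
  "min_code A bs =
     map Min bs @ map (block_min (set bs)) (desc (A - Min ` set bs))"

definition min_codes :: "nat set \<Rightarrow> nat list set" where
  "min_codes A =
     {\<sigma> @ \<rho> | \<sigma> \<rho>. distinct \<sigma> \<and> set \<sigma> \<subseteq> A \<and> set \<rho> \<subseteq> set \<sigma> \<and>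
        list_all2 (<) \<rho> (desc (A - set \<sigma>))}"

lemma block_min_eq:
  assumes "partition_on A P" "B \<in> P" "x \<in> B"
  shows "block_min P x = Min B"
proof -
  have "{B \<in> P. x \<in> B} = {B}" using assms by (auto simp: partition_on_def disjoint_def)
  then show ?thesis by (simp add: block_min_def)
qed

lemma Min_block_in:
  fixes A :: "nat set"
  assumes "finite A" "partition_on A P" "B \<in> P"
  shows "Min B \<in> B" "finite B"
proof -
  show "finite B" using assms by (auto simp: partition_on_def intro: finite_subset)
  then show "Min B \<in> B" using assms by (auto simp: partition_on_def intro!: Min_in)
qed

lemma inj_on_Min_partition:
  fixes A :: "nat set"
  assumes "finite A" "partition_on A P"
  shows "inj_on Min P"
proof (rule inj_onI)
  fix B C assume "B \<in> P" "C \<in> P" "Min B = Min C"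
  then show "B = C" using Min_block_in[OF assms] assms(2)
    by (metis disjoint_def disjoint_iff partition_on_def)
qed

text \<open>A partition can be recovered from the map sending each point to the minimum of its block; this is
  what makes the coding injective.\<close>

lemma block_eq_block_min_fibre:
  assumes "finite A" "partition_on A P" "B \<in> P"
  shows "B = {x \<in> A. block_min P x = Min B}"
proof (intro equalityI subsetI)
  fix x assume "x \<in> B"
  then show "x \<in> {x \<in> A. block_min P x = Min B}"
    using assms block_min_eq by (auto simp: partition_on_def)
next
  fix x assume x: "x \<in> {x \<in> A. block_min P x = Min B}"
  then obtain C where C: "C \<in> P" "x \<in> C" using assms(2) unfolding partition_on_def by blast
  then have "Min C = Min B" using x block_min_eq[OF assms(2) C] by simp
  then have "C = B" using inj_on_Min_partition[OF assms(1,2)] C(1) assms(3) by (auto dest: inj_onD)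
  then show "x \<in> B" using C by simp
qed

text \<open>The border between the two parts of the code can be read off: the second part only repeats letters
  of the first, so the first part has as many entries as the code has distinct letters. The two
  parts together then give \<open>block_min\<close> on all of \<open>A\<close>.\<close>

lemma inj_on_min_code:
  assumes A: "finite A"
  shows "inj_on (min_code A) (ordered_partitions A)"
proof (rule inj_onI)
  fix bs cs assume b: "bs \<in> ordered_partitions A" and c: "cs \<in> ordered_partitions A"
    and eq: "min_code A bs = min_code A cs"
  have *: "card (set (min_code A ds)) = length ds"
    and **: "ds = map (\<lambda>m. {x \<in> A. block_min (set ds) x = m}) (map Min ds)"
    if "ds \<in> ordered_partitions A" for ds
  proof -
    from that have d: "distinct ds" and p: "partition_on A (set ds)"
      by (auto simp: ordered_partitions_def)
    have "block_min (set ds) x \<in> Min ` set ds" if "x \<in> A" for x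
    proof -
      obtain B where "B \<in> set ds" "x \<in> B" using \<open>x \<in> A\<close> p unfolding partition_on_def by blast
      then show ?thesis using block_min_eq[OF p] by auto
    qed
    then have "set (min_code A ds) = Min ` set ds"
      using A by (auto simp: min_code_def desc_props)
    then show "card (set (min_code A ds)) = length ds"
      using inj_on_Min_partition[OF A p] d by (simp add: card_image distinct_card)
    show "ds = map (\<lambda>m. {x \<in> A. block_min (set ds) x = m}) (map Min ds)"
      using block_eq_block_min_fibre[OF A p] by (auto intro!: nth_equalityI)
  qed
  have len: "length bs = length cs" using *[OF b] *[OF c] eq by simp
  then have mins: "map Min bs = map Min cs" 
    and rest: "map (block_min (set bs)) (desc (A - Min ` set bs))
      = map (block_min (set cs)) (desc (A - Min ` set cs))"
    using eq by (simp_all add: min_code_def)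
  have M: "Min ` set bs = Min ` set cs" using mins by (metis list.set_map)
  have fix_min: "block_min (set ds) m = m" if "ds \<in> ordered_partitions A" "m \<in> Min ` set ds" for ds m
    using that Min_block_in[OF A] block_min_eq by (fastforce simp: ordered_partitions_def)
  have "block_min (set bs) x = block_min (set cs) x" if "x \<in> A" for x
  proof (cases "x \<in> Min ` set bs")
    case True
    then show ?thesis using fix_min[OF b] fix_min[OF c] M by simp
  next
    case False
    then show ?thesis using rest that A unfolding M by (auto simp: desc_props)
  qed
  then have "(\<lambda>m. {x \<in> A. block_min (set bs) x = m}) = (\<lambda>m. {x \<in> A. block_min (set cs) x = m})"
    by auto
  then show "bs = cs" using **[OF b] **[OF c] mins by metis
qed

lemma min_code_in:
  assumes A: "finite A" and bs: "bs \<in> ordered_partitions A"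
  shows "min_code A bs \<in> min_codes A"
proof -
  from bs have d: "distinct bs" and p: "partition_on A (set bs)"
    by (auto simp: ordered_partitions_def)
  let ?M = "Min ` set bs"
  have sub: "?M \<subseteq> A" using Min_block_in[OF A p] p by (auto simp: partition_on_def)
  have less: "block_min (set bs) x \<in> ?M \<and> block_min (set bs) x < x" if x: "x \<in> A - ?M" for x
  proof -
    obtain B where B: "B \<in> set bs" "x \<in> B" using x p unfolding partition_on_def by blast
    have "Min B \<le> x" using B Min_block_in[OF A p] by simp
    then show ?thesis using B x block_min_eq[OF p B] by (auto simp: order_less_le)
  qed
  have "distinct (map Min bs)" using d inj_on_Min_partition[OF A p] by (simp add: distinct_map)
  moreover have "list_all2 (<) (map (block_min (set bs)) (desc (A - ?M))) (desc (A - ?M))"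
    using less A by (auto simp: list_all2_map1 desc_props list_all2_same)
  moreover have "set (map (block_min (set bs)) (desc (A - ?M))) \<subseteq> ?M"
    using less A by (auto simp: desc_props)
  ultimately show ?thesis unfolding min_codes_def min_code_def using sub
    by (intro CollectI exI conjI) (auto dest: subsetD)
qed

text \<open>From \<open>\<sigma>\<close> and \<open>\<rho>\<close> one forms the map \<open>g\<close> that fixes \<open>\<sigma>\<close> and sends each other element to the entry of
  \<open>\<rho>\<close> standing against it. As \<open>g x \<le> x\<close>, with equality on \<open>\<sigma>\<close>, the fibre over \<open>s\<close> has minimum \<open>s\<close>, so
  the list of fibres has the prescribed code.\<close>

lemma min_codes_subset_image:
  assumes A: "finite A"
  shows "min_codes A \<subseteq> min_code A ` ordered_partitions A"
proof
  fix as assume "as \<in> min_codes A"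
  then obtain \<sigma> \<rho> where as: "as = \<sigma> @ \<rho>" and d: "distinct \<sigma>" and \<sigma>: "set \<sigma> \<subseteq> A"
    and \<rho>: "set \<rho> \<subseteq> set \<sigma>" and less: "list_all2 (<) \<rho> (desc (A - set \<sigma>))"
    by (auto simp: min_codes_def)
  define F where "F = desc (A - set \<sigma>)"
  have F: "set F = A - set \<sigma>" "distinct F" using A by (auto simp: F_def desc_props)
  have len: "length F = length \<rho>" using less by (auto simp: F_def list_all2_lengthD)
  define g where "g x = (if x \<in> set \<sigma> then x else the (map_of (zip F \<rho>) x))" for x
  have g_nth: "g (F ! i) = \<rho> ! i" if "i < length F" for i
    using that len F nth_mem[OF that] by (auto simp: g_def map_of_zip_nth)
  have g_fix: "g s = s" if "s \<in> set \<sigma>" for s using that by (simp add: g_def)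
  have g_in: "g x \<in> set \<sigma> \<and> g x \<le> x" if x: "x \<in> A" for x
  proof (cases "x \<in> set \<sigma>")
    case False
    then obtain i where i: "i < length F" "x = F ! i" using x F by (metis DiffI in_set_conv_nth)
    then have "\<rho> ! i < F ! i" using less len by (simp add: F_def list_all2_conv_all_nth)
    then show ?thesis using i g_nth \<rho> len by auto
  qed (simp add: g_fix)
  define C where "C s = {x \<in> A. g x = s}" for s
  have C_self: "s \<in> C s" if "s \<in> set \<sigma>" for s using that \<sigma> by (auto simp: C_def g_fix)
  have C_min: "Min (C s) = s" if "s \<in> set \<sigma>" for s
    by (rule Min_eqI) (use A g_in C_self[OF that] in \<open>auto simp: C_def\<close>)
  define bs where "bs = map C \<sigma>"
  have set_bs: "set bs = C ` set \<sigma>" by (simp add: bs_def)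
  have "g ` A = set \<sigma>" using g_in g_fix \<sigma> by force
  then have bs: "bs \<in> ordered_partitions A"
    unfolding bs_def C_def by (intro map_fibres_in_ordered_partitions d) simp
  then have p: "partition_on A (set bs)" by (simp add: ordered_partitions_def)
  have mins: "map Min bs = \<sigma>" using C_min by (simp add: bs_def map_idI)
  then have M: "Min ` set bs = set \<sigma>" by (metis list.set_map)
  have bm: "block_min (set bs) x = g x" if "x \<in> A" for x
  proof -
    have "C (g x) \<in> set bs" "x \<in> C (g x)" using that g_in by (auto simp: set_bs C_def)
    from block_min_eq[OF p this] show ?thesis using C_min g_in[OF that] by simp
  qed
  have "map (block_min (set bs)) F = \<rho>"
  proof (rule nth_equalityI)
    fix i assume "i < length (map (block_min (set bs)) F)"
    then have i: "i < length F" by simp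
    then have "F ! i \<in> A" using F nth_mem[OF i] by auto
    then show "map (block_min (set bs)) F ! i = \<rho> ! i" using i bm g_nth by simp
  qed (simp add: len)
  then have "min_code A bs = as" by (simp add: min_code_def mins M as F_def)
  then show "as \<in> min_code A ` ordered_partitions A" using bs by blast
qed

lemma bij_betw_min_code:
  assumes "finite A"
  shows "bij_betw (min_code A) (ordered_partitions A) (min_codes A)"
  unfolding bij_betw_def
  using inj_on_min_code[OF assms] min_code_in[OF assms] min_codes_subset_image[OF assms] by blast

section \<open>Parking\<close>

text \<open>For an occupied preference, maximality of the chosen spot is expressed as \<open>{s<..n} \<subseteq> occ\<close>: no spot
  at all above \<open>s\<close> is free. This is the form in which the later arguments use the parking rule.\<close>

lemma frustrated_spot_eq_Some_iff:
  "frustrated_spot n occ a = Some s \<longleftrightarrow>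
     (if a \<notin> occ then s = a else a < s \<and> s \<le> n \<and> s \<notin> occ \<and> {s<..n} \<subseteq> occ)"
proof (cases "a \<in> occ")
  case True
  define free where "free = {s. a < s \<and> s \<le> n \<and> s \<notin> occ}"
  have fin: "finite free" by (rule finite_subset[of _ "{..n}"]) (auto simp: free_def)
  have "frustrated_spot n occ a = Some s \<longleftrightarrow> free \<noteq> {} \<and> Max free = s"
    using True by (auto simp: frustrated_spot_def free_def Let_def)
  also have "\<dots> \<longleftrightarrow> s \<in> free \<and> (\<forall>t\<in>free. t \<le> s)"
    using fin by (metis Max_eq_iff empty_iff)
  also have "\<dots> \<longleftrightarrow> a < s \<and> s \<le> n \<and> s \<notin> occ \<and> {s<..n} \<subseteq> occ"
    by (auto simp: free_def not_le subset_iff) (meson less_trans not_le)+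
  finally show ?thesis using True by simp
qed (auto simp: frustrated_spot_def)

lemma park_from_eq_map_Some_iff:
  "park_from n occ as = map Some ss \<longleftrightarrow>
     length ss = length as \<and>
     (\<forall>i<length as. frustrated_spot n (occ \<union> set (take i ss)) (as ! i) = Some (ss ! i))"
proof (induction as arbitrary: occ ss)
  case (Cons a as)
  show ?case
  proof (cases ss)
    case (Cons s ss')
    have "park_from n occ (a # as) = map Some ss \<longleftrightarrow>
        frustrated_spot n occ a = Some s \<and> park_from n (insert s occ) as = map Some ss'"
      using Cons by (auto split: option.splits)
    then show ?thesis unfolding Cons.IH by (auto simp: Cons All_less_Suc2)
  qed (auto split: option.splits)
qed auto

text \<open>The list \<open>ss\<close> records the spots in order of arrival. List positions start at 0, so \<open>ss ! i\<close> is the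
  spot of car \<open>i + 1\<close>.\<close>

definition parks :: "nat \<Rightarrow> nat list \<Rightarrow> nat list \<Rightarrow> bool" where
  "parks n as ss \<longleftrightarrow> length as = n \<and> set as \<subseteq> {1..n} \<and> outcome n as = map Some ss"

lemma frustrated_pf_iff_parks: "frustrated_pf n as \<longleftrightarrow> (\<exists>ss. parks n as ss)"
proof -
  have "(\<forall>x\<in>set xs. x \<noteq> None) \<longleftrightarrow> (\<exists>ss. xs = map Some ss)" for xs :: "nat option list"
    by (metis (no_types, lifting) ex_map_conv option.distinct(1) option.exhaust)
  then show ?thesis by (auto simp: frustrated_pf_def parks_def)
qed

lemma parks_nth:
  assumes "parks n as ss" "i < n"
  shows "if as ! i \<notin> set (take i ss) then ss ! i = as ! i
    else as ! i < ss ! i \<and> ss ! i \<le> n \<and> ss ! i \<notin> set (take i ss) \<and> {ss ! i<..n} \<subseteq> set (take i ss)"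
  using assms by (simp add: parks_def outcome_def park_from_eq_map_Some_iff frustrated_spot_eq_Some_iff
      del: if_split)

lemma parks_permutation:
  assumes p: "parks n as ss"
  shows "length ss = n" "distinct ss" "set ss = {1..n}"
proof -
  show len: "length ss = n" using p by (simp add: parks_def outcome_def park_from_eq_map_Some_iff)
  have "ss ! i \<notin> set (take i ss) \<and> ss ! i \<in> {1..n}" if "i < n" for i
  proof -
    have "as ! i \<in> {1..n}" using p that nth_mem[of i as] unfolding parks_def by blast
    then show ?thesis using parks_nth[OF p that] by (auto split: if_splits)
  qed
  then have fresh: "ss ! i \<notin> set (take i ss)" and sub: "ss ! i \<in> {1..n}" if "i < n" for i
    using that by auto
  show d: "distinct ss"
    unfolding distinct_conv_nth
  proof (intro allI impI)
    have "ss ! i \<noteq> ss ! j" if "i < j" "j < n" for i j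
      using fresh[OF that(2)] that len by (auto simp: in_set_conv_nth)
    then show "ss ! i \<noteq> ss ! j" if "i < length ss" "j < length ss" "i \<noteq> j" for i j
      using that len by (metis nat_neq_iff)
  qed
  have "set ss \<subseteq> {1..n}" using sub len by (force simp: in_set_conv_nth)
  then show "set ss = {1..n}" using d len by (intro card_subset_eq) (auto simp: distinct_card)
qed

lemma lucky_car_iff:
  assumes "parks n as ss" "i < n"
  shows "lucky_car n as (Suc i) \<longleftrightarrow> ss ! i = as ! i"
  using assms parks_permutation[OF assms(1)] by (simp add: lucky_car_def car_spot_def parks_def)

lemma lucky_spot_iff:
  assumes p: "parks n as ss" and i: "i < n"
  shows "lucky_spot n as (ss ! i) \<longleftrightarrow> ss ! i = as ! i"
proof -
  note ss = parks_permutation[OF p]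
  have "lucky_spot n as (ss ! i) \<longleftrightarrow> (\<exists>j<n. ss ! j = ss ! i \<and> ss ! j = as ! j)"
  proof -
    have "{1..n} = Suc ` {..<n}" by (simp add: image_Suc_lessThan)
    then have "lucky_spot n as (ss ! i) \<longleftrightarrow>
        (\<exists>j<n. car_spot n as (Suc j) = Some (ss ! i) \<and> lucky_car n as (Suc j))"
      unfolding lucky_spot_def by auto
    moreover have "car_spot n as (Suc j) = Some (ss ! j)" if "j < n" for j
      using p ss(1) that by (simp add: car_spot_def parks_def)
    ultimately show ?thesis using lucky_car_iff[OF p] by auto
  qed
  then show ?thesis using ss i by (auto simp: nth_eq_iff_index_eq)
qed

text \<open>When an unlucky car parks in \<open>s\<close>, all spots above \<open>s\<close> are already taken, so every later car ends up
  below \<open>s\<close>.\<close>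

lemma unlucky_parks:
  assumes p: "parks n as ss" and i: "i < n" "ss ! i \<noteq> as ! i"
  shows "as ! i \<in> set (take i ss)" "as ! i < ss ! i"
    and "j < n \<Longrightarrow> i < j \<Longrightarrow> ss ! j < ss ! i"
proof -
  note ss = parks_permutation[OF p]
  have *: "as ! i \<in> set (take i ss) \<and> as ! i < ss ! i \<and> {ss ! i<..n} \<subseteq> set (take i ss)"
    using parks_nth[OF p i(1)] i(2) by (auto split: if_splits)
  then show "as ! i \<in> set (take i ss)" "as ! i < ss ! i" by auto
  show "ss ! j < ss ! i" if j: "j < n" "i < j"
  proof (rule ccontr)
    assume "\<not> ss ! j < ss ! i"
    moreover have "ss ! j \<noteq> ss ! i" using ss i j by (simp add: nth_eq_iff_index_eq)
    ultimately have "ss ! i < ss ! j" by simp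
    moreover have "ss ! j \<in> {1..n}" using ss j by (metis nth_mem)
    ultimately have "ss ! j \<in> set (take i ss)" using * by auto
    then show False using ss j by (auto simp: in_set_conv_nth nth_eq_iff_index_eq)
  qed
qed

section \<open>Lucky spots forming an initial segment\<close>

lemma initial_segment_iff:
  fixes n :: nat
  shows "(\<forall>i\<in>{1..n}. \<not> L i \<longrightarrow> (\<forall>j\<in>{1..n}. j > i \<longrightarrow> \<not> L j)) \<longleftrightarrow>
     (\<exists>k\<le>n. \<forall>i\<in>{1..n}. L i \<longleftrightarrow> i \<le> k)"
proof
  assume *: "\<forall>i\<in>{1..n}. \<not> L i \<longrightarrow> (\<forall>j\<in>{1..n}. j > i \<longrightarrow> \<not> L j)"
  define k where "k = Max (insert 0 {i \<in> {1..n}. L i})"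
  have "k \<in> insert 0 {i \<in> {1..n}. L i}" unfolding k_def by (rule Max_in) auto
  then have k: "k \<le> n" "k = 0 \<or> k \<in> {1..n} \<and> L k" by auto
  have "i \<le> k" if "i \<in> {1..n}" "L i" for i unfolding k_def using that by (intro Max_ge) auto
  moreover have "L i" if "i \<in> {1..n}" "i \<le> k" for i using * k(2) that by (cases "i = k") auto
  ultimately show "\<exists>k\<le>n. \<forall>i\<in>{1..n}. L i \<longleftrightarrow> i \<le> k" using k(1) by blast
next
  assume "\<exists>k\<le>n. \<forall>i\<in>{1..n}. L i \<longleftrightarrow> i \<le> k"
  then show "\<forall>i\<in>{1..n}. \<not> L i \<longrightarrow> (\<forall>j\<in>{1..n}. j > i \<longrightarrow> \<not> L j)"
    by (meson le_trans less_imp_le_nat)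
qed

text \<open>A preference above \<open>k\<close> would belong to an unlucky car, and the preferred spot would be occupied by an
  earlier unlucky car. The later of the two parks above its preference, hence above the earlier
  one, which \<open>unlucky_parks\<close> forbids.\<close>

lemma set_preferences_if_lucky_spots_initial:
  assumes p: "parks n as ss" and k: "k \<le> n" "\<forall>s\<in>{1..n}. lucky_spot n as s \<longleftrightarrow> s \<le> k"
  shows "set as = {1..k}"
proof -
  note ss = parks_permutation[OF p]
  have len: "length as = n" using p by (simp add: parks_def)
  have luck: "ss ! i = as ! i \<longleftrightarrow> ss ! i \<le> k" if "i < n" for i
    using k(2) lucky_spot_iff[OF p that] ss(1,3) nth_mem[of i ss] that by auto
  have "s \<in> set as" if "s \<in> {1..k}" for s
  proof -
    have "s \<in> set ss" using that k ss by auto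
    then obtain i where "i < n" "ss ! i = s" using ss by (metis in_set_conv_nth)
    then show ?thesis using luck[of i] that len nth_mem[of i as] by auto
  qed
  moreover have "as ! i \<le> k" if i: "i < n" for i
  proof (rule ccontr)
    assume big: "\<not> as ! i \<le> k"
    then have un: "ss ! i \<noteq> as ! i" using luck[OF i] by auto
    obtain j where j: "j < i" "as ! i = ss ! j"
      using unlucky_parks(1)[OF p i un] ss i by (auto simp: in_set_conv_nth)
    then have "ss ! j \<noteq> as ! j" using big luck[of j] i by auto
    then have "ss ! i < ss ! j" using unlucky_parks(3)[OF p, of j i] i j by simp
    then show False using unlucky_parks(2)[OF p i un] j by simp
  qed
  moreover have "set as \<subseteq> {1..n}" using p by (simp add: parks_def)
  ultimately show ?thesis using len by (auto simp: in_set_conv_nth subset_iff)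
qed

text \<open>The occupied spots always consist of a set \<open>L\<close> of lucky ones in \<open>{1..k}\<close> and a top segment
  \<open>{m<..n}\<close> filled by unlucky cars. The equation \<open>length as + card L = m\<close> says that the
  remaining cars are as many as the free spots. An unlucky car takes \<open>m\<close>.\<close>

lemma park_from_initial_word:
  assumes "L \<subseteq> {1..k}" "L \<union> set as = {1..k}" "k \<le> m" "m \<le> n" "length as + card L = m"
  shows "\<exists>ss. park_from n (L \<union> {m<..n}) as = map Some ss \<and>
    (\<forall>i<length as. ss ! i = as ! i \<or> k < ss ! i)"
  using assms
proof (induction as arbitrary: L m)
  case (Cons a as)
  have finL: "finite L" using Cons.prems(1) finite_subset by blast
  have a: "a \<in> {1..k}" using Cons.prems by auto
  have ext: ?case if "frustrated_spot n (L \<union> {m<..n}) a = Some s" "s = a \<or> k < s"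
    "park_from n (insert s (L \<union> {m<..n})) as = map Some ss"
    "\<forall>i<length as. ss ! i = as ! i \<or> k < ss ! i" for s ss
    using that by (intro exI[of _ "s # ss"]) (auto simp: nth_Cons split: nat.split)
  show ?case
  proof (cases "a \<in> L")
    case True
    \<comment> \<open>This car contributes nothing new to \<open>{1..k}\<close>, so the remaining ones must cover
      \<open>{1..k} - L\<close>; counting cars then leaves room above \<open>k\<close>, that is \<open>k < m\<close>.\<close>
    have "card ({1..k} - L) \<le> length as"
    proof -
      have "{1..k} - L \<subseteq> set as" using Cons.prems(2) True by auto
      then show ?thesis by (meson List.finite_set card_length card_mono le_trans)
    qed
    moreover have "card ({1..k} - L) = k - card L"
      using Cons.prems(1) finL by (simp add: card_Diff_subset)
    moreover have "card L \<le> k" using card_mono[OF _ Cons.prems(1)] by simp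
    ultimately have m: "k < m" using Cons.prems(5) by simp
    have occ: "insert m (L \<union> {m<..n}) = L \<union> {m - 1<..n}" using m Cons.prems(4) by auto
    have "m \<notin> L" using m Cons.prems(1) by auto
    then have "frustrated_spot n (L \<union> {m<..n}) a = Some m"
      using True a m Cons.prems(4) by (auto simp: frustrated_spot_eq_Some_iff)
    moreover have "\<exists>ss. park_from n (L \<union> {m - 1<..n}) as = map Some ss \<and>
        (\<forall>i<length as. ss ! i = as ! i \<or> k < ss ! i)"
      by (rule Cons.IH) (use Cons.prems True m in auto)
    ultimately show ?thesis using ext m occ by metis
  next
    case False
    have "frustrated_spot n (L \<union> {m<..n}) a = Some a"
      using False a Cons.prems(3) by (auto simp: frustrated_spot_eq_Some_iff)
    moreover have "\<exists>ss. park_from n (insert a L \<union> {m<..n}) as = map Some ss \<and>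
        (\<forall>i<length as. ss ! i = as ! i \<or> k < ss ! i)"
      by (rule Cons.IH) (use Cons.prems False a finL in auto)
    ultimately show ?thesis using ext by (metis Un_insert_left)
  qed
qed auto

lemma lucky_spots_initial_iff:
  "frustrated_pf n as \<and>
     (\<forall>i\<in>{1..n}. \<not> lucky_spot n as i \<longrightarrow> (\<forall>j\<in>{1..n}. j > i \<longrightarrow> \<not> lucky_spot n as j)) \<longleftrightarrow>
   as \<in> initial_words n"
  (is "?lhs \<longleftrightarrow> _")
proof
  assume ?lhs
  then show "as \<in> initial_words n"
    unfolding initial_segment_iff frustrated_pf_iff_parks initial_words_def
    using set_preferences_if_lucky_spots_initial parks_def by blast
next
  assume "as \<in> initial_words n"
  then obtain k where len: "length as = n" and k: "set as = {1..k}"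
    unfolding initial_words_def by blast
  have kn: "k \<le> n" using card_length[of as] k len by simp
  obtain ss where ss: "park_from n {} as = map Some ss" "\<And>i. i < n \<Longrightarrow> ss ! i = as ! i \<or> k < ss ! i"
    using park_from_initial_word[of "{}" k as n n] k kn len by auto
  have p: "parks n as ss" using ss len k kn by (auto simp: parks_def outcome_def)
  have "lucky_spot n as s \<longleftrightarrow> s \<le> k" if "s \<in> {1..n}" for s
  proof -
    have "s \<in> set ss" using that parks_permutation[OF p] by auto
    then obtain i where i: "i < n" "s = ss ! i"
      using parks_permutation(1)[OF p] by (auto simp: in_set_conv_nth)
    moreover have "as ! i \<le> k" using k len i nth_mem[of i as] by auto
    ultimately show ?thesis using lucky_spot_iff[OF p i(1)] ss(2)[OF i(1)] by auto
  qed
  then show ?lhs unfolding initial_segment_iff frustrated_pf_iff_parks using p kn by blast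
qed

section \<open>Lucky cars forming an initial segment\<close>

text \<open>The later cars are all unlucky, so by \<open>unlucky_parks\<close> their spots decrease, which forces them to be
  the spots outside \<open>\<sigma> = take k as\<close> in decreasing order. The preference of such a car is the spot of
  an earlier car; that car is lucky, as the spots of earlier unlucky cars are too large.\<close>

lemma min_code_if_lucky_cars_initial:
  assumes p: "parks n as ss" and k: "k \<le> n" "\<forall>j\<in>{1..n}. lucky_car n as j \<longleftrightarrow> j \<le> k"
  shows "as \<in> min_codes {1..n}"
proof -
  note ss = parks_permutation[OF p]
  have len: "length as = n" using p by (simp add: parks_def)
  have luck: "ss ! i = as ! i \<longleftrightarrow> i < k" if "i < n" for i
    using k(2) lucky_car_iff[OF p that] that by (auto simp: Suc_le_eq)
  have take_eq: "take k ss = take k as"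
    using luck k ss(1) len by (intro nth_equalityI) auto
  have "sorted_wrt (>) (drop k ss)"
    unfolding sorted_wrt_iff_nth_less using ss(1) luck unlucky_parks(3)[OF p] by auto
  then have "drop k ss = desc (set (drop k ss))" by (rule desc_unique)
  also have "set (drop k ss) = {1..n} - set (take k as)"
  proof -
    have "set (take k ss) \<union> set (drop k ss) = {1..n}"
      using ss(3) by (metis append_take_drop_id set_append)
    moreover have "set (take k ss) \<inter> set (drop k ss) = {}"
      using ss(2) by (intro set_take_disj_set_drop_if_distinct) simp_all
    ultimately show ?thesis unfolding take_eq by blast
  qed
  finally have drop_eq: "drop k ss = desc ({1..n} - set (take k as))" .
  have rest: "as ! i \<in> set (take k ss)" if i: "i < n" "k \<le> i" for i
  proof (rule ccontr)
    assume notin: "as ! i \<notin> set (take k ss)"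
    have un: "ss ! i \<noteq> as ! i" using luck i by auto
    obtain j where j: "j < i" "as ! i = ss ! j"
      using unlucky_parks(1)[OF p i(1) un] ss i by (auto simp: in_set_conv_nth)
    have "\<not> j < k" using notin j i ss(1) k by (auto simp: in_set_conv_nth)
    then have "ss ! i < ss ! j" using unlucky_parks(3)[OF p, of j i] luck[of j] i j by simp
    then show False using unlucky_parks(2)[OF p i(1) un] j by simp
  qed
  have "list_all2 (<) (drop k as) (drop k ss)"
    using unlucky_parks(2)[OF p] luck ss(1) len by (auto simp: list_all2_conv_all_nth)
  moreover have "set (drop k as) \<subseteq> set (take k as)"
    using rest len take_eq by (auto simp: in_set_conv_nth[of _ "drop k as"])
  moreover have "distinct (take k as)" using ss(2) take_eq by (metis distinct_take)
  moreover have "set (take k as) \<subseteq> {1..n}" using p set_take_subset unfolding parks_def by fast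
  ultimately show ?thesis unfolding min_codes_def drop_eq
    by (intro CollectI exI[of _ "take k as"] exI[of _ "drop k as"]) simp
qed

text \<open>Conversely, the code \<open>\<sigma> @ \<rho>\<close> parks its cars at \<open>\<sigma> @ F\<close>, where \<open>F\<close> lists the spots outside \<open>\<sigma>\<close> in
  decreasing order: whenever \<open>F ! j\<close> is to be taken, the spots above it lie in \<open>\<sigma>\<close> or earlier in \<open>F\<close>.\<close>

lemma lucky_cars_initial_iff:
  "frustrated_pf n as \<and>
     (\<forall>i\<in>{1..n}. \<not> lucky_car n as i \<longrightarrow> (\<forall>j\<in>{1..n}. j > i \<longrightarrow> \<not> lucky_car n as j)) \<longleftrightarrow>
   as \<in> min_codes {1..n}"
  (is "?lhs \<longleftrightarrow> _")
proof
  assume ?lhs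
  then show "as \<in> min_codes {1..n}"
    unfolding initial_segment_iff frustrated_pf_iff_parks
    using min_code_if_lucky_cars_initial by blast
next
  assume "as \<in> min_codes {1..n}"
  then obtain \<sigma> \<rho> where as: "as = \<sigma> @ \<rho>" and d: "distinct \<sigma>" and \<sigma>: "set \<sigma> \<subseteq> {1..n}"
    and \<rho>: "set \<rho> \<subseteq> set \<sigma>" and less: "list_all2 (<) \<rho> (desc ({1..n} - set \<sigma>))"
    by (auto simp: min_codes_def)
  define k where "k = length \<sigma>"
  define F where "F = desc ({1..n} - set \<sigma>)"
  have F: "set F = {1..n} - set \<sigma>" "distinct F" "sorted_wrt (>) F"
    by (simp_all add: F_def desc_props)
  have lenF: "length F = length \<rho>" using less by (simp add: F_def list_all2_lengthD)
  have "k + length F = n"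
    using F \<sigma> d by (metis Diff_partition Diff_disjoint card_Un_disjoint List.finite_set
        card_atLeastAtMost diff_Suc_1 distinct_card k_def)
  then have len: "length as = n" and kn: "k \<le> n" using lenF as k_def by auto
  have less_nth: "\<rho> ! i < F ! i" if "i < length F" for i
    using less that lenF by (simp add: F_def list_all2_conv_all_nth)
  let ?ss = "\<sigma> @ F"
  have step: "frustrated_spot n (set (take i ?ss)) (as ! i) = Some (?ss ! i)" if i: "i < n" for i
  proof (cases "i < k")
    case True
    then have "\<sigma> ! i \<notin> set (take i \<sigma>)"
      using d k_def by (auto simp: in_set_conv_nth nth_eq_iff_index_eq)
    then show ?thesis using True by (simp add: frustrated_spot_eq_Some_iff as nth_append k_def)
  next
    case False
    define j where "j = i - k"
    have j: "j < length F" "i = k + j" using False i len lenF as k_def j_def by auto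
    have Fj: "F ! j \<in> {1..n} - set \<sigma>" using F j by (metis nth_mem)
    have fresh: "F ! j \<notin> set (take j F)"
      using F j by (auto simp: in_set_conv_nth nth_eq_iff_index_eq)
    have above: "{F ! j<..n} \<subseteq> set \<sigma> \<union> set (take j F)"
    proof
      fix t assume "t \<in> {F ! j<..n}"
      then have t: "F ! j < t" "t \<le> n" by auto
      show "t \<in> set \<sigma> \<union> set (take j F)"
      proof (cases "t \<in> set \<sigma>")
        case False
        then obtain l where l: "l < length F" "t = F ! l" using F t
          by (metis Diff_iff atLeastAtMost_iff in_set_conv_nth le_trans less_imp_le Fj)
        then have "l < j" using F(3) t j by (metis less_asym linorder_neqE_nat sorted_wrt_nth_less)
        then show ?thesis using l j by (auto simp: in_set_conv_nth)
      qed simp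
    qed
    have "\<rho> ! j \<in> set \<sigma>" using \<rho> j lenF by auto
    then have "frustrated_spot n (set \<sigma> \<union> set (take j F)) (\<rho> ! j) = Some (F ! j)"
      unfolding frustrated_spot_eq_Some_iff using less_nth[OF j(1)] Fj fresh above by simp
    then show ?thesis using j by (simp add: as nth_append k_def)
  qed
  have p: "parks n as ?ss"
    unfolding parks_def outcome_def park_from_eq_map_Some_iff
    using step len lenF \<sigma> \<rho> by (auto simp: as)
  have "lucky_car n as j \<longleftrightarrow> j \<le> k" if j: "j \<in> {1..n}" for j
  proof -
    obtain i where i: "j = Suc i" "i < n" using j by (cases j) auto
    have "?ss ! i = as ! i \<longleftrightarrow> i < k"
    proof (cases "i < k")
      case False
      then have "i - k < length F" using i len lenF by (auto simp: as k_def)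
      then show ?thesis using less_nth[of "i - k"] False by (simp add: as nth_append k_def)
    qed (simp add: as nth_append k_def)
    then show ?thesis using lucky_car_iff[OF p i(2)] i by auto
  qed
  then show ?lhs unfolding initial_segment_iff frustrated_pf_iff_parks using p kn by blast
qed

theorem corollary2p24:
  fixes n :: nat
  assumes "n \<ge> 1"
  shows "card {as. frustrated_pf n as \<and>
            (\<forall>i \<in> {1..n}. \<not> lucky_spot n as i \<longrightarrow> (\<forall>j \<in> {1..n}. j > i \<longrightarrow> \<not> lucky_spot n as j))}
           = fubini n \<and>
         card {as. frustrated_pf n as \<and>
            (\<forall>i \<in> {1..n}. \<not> lucky_car n as i \<longrightarrow> (\<forall>j \<in> {1..n}. j > i \<longrightarrow> \<not> lucky_car n as j))}
           = fubini n"
  unfolding lucky_spots_initial_iff lucky_cars_initial_iff Collect_mem_eq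
    fubini_eq_card_ordered_partitions[OF assms]
  using bij_betw_same_card[OF bij_betw_letter_classes[of n]]
    bij_betw_same_card[OF bij_betw_min_code[OF finite_atLeastAtMost[of 1 n]]]
  by (intro conjI) (erule sym | assumption)+

end
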